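(* Let $K\subset\mathbb{H}^2$ be a convex body in the hyperbolic plane. Then for every $\delta>0$ the illumination body $$\mathcal{I}_\delta^h(K)=\{\mathbf{x}\in\mathbb{H}^2:\mathrm{vol}_2^h([\mathbf{x},K]\setminus K)\le\delta\}$$ is (geodesically) convex.
   Context: $\mathbb{H}^2$ is the hyperbolic plane (constant curvature $-1$) and $\mathrm{vol}_2^h$ is the hyperbolic area measure. A convex body is a compact, geodesically convex set with nonempty interior. $[\mathbf{x},K]=\mathrm{conv}(\{\mathbf{x}\}\cup K)$, where $\mathrm{conv}$ denotes the geodesic convex hull. *)

theory Defs
  imports "HOL-Analysis.Analysis"
begin

text \<open>
  The hyperbolic plane of curvature -1 in the Beltrami-Klein (projective disc) model: the open unit
  disc with the Riemannian metric
  \[ g_x(v,w) = \frac{v \cdot w}{1-|x|^2} + \frac{(x \cdot v)(x \cdot w)}{(1-|x|^2)^2}. \]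
  Its topology is the Euclidean subspace topology of the open unit disc, so for subsets of the disc
  compactness and interior are the ordinary ones.
\<close>

definition hyp_plane :: "(real^2) set" where
  "hyp_plane = ball 0 1"

text \<open>
  In the hyperboloid model the point \<open>x\<close> is represented by \<open>(1, x) / sqrt (1 - |x|^2)\<close>, and the
  argument of \<open>arcosh\<close> is minus the Lorentz product of the two representatives.
\<close>

definition hyp_dist :: "real^2 \<Rightarrow> real^2 \<Rightarrow> real" where
  "hyp_dist x y = arcosh ((1 - x \<bullet> y) / (sqrt (1 - (norm x)\<^sup>2) * sqrt (1 - (norm y)\<^sup>2)))"

text \<open>The Riemannian area element is \<open>sqrt (det g_x) dx\<close>, where \<open>det g_x = (1 - |x|^2)^(-3)\<close>.\<close>

definition hyp_area :: "(real^2) measure" where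
  "hyp_area = density lborel
     (\<lambda>x. indicator hyp_plane x * ennreal (1 / sqrt ((1 - (norm x)\<^sup>2) ^ 3)))"

text \<open>A (minimising) geodesic of length \<open>l\<close>, parametrised by arc length on \<open>{0..l}\<close>.\<close>

definition hyp_geodesic :: "(real \<Rightarrow> real^2) \<Rightarrow> real \<Rightarrow> bool" where
  "hyp_geodesic \<gamma> l \<longleftrightarrow> 0 \<le> l \<and> \<gamma> ` {0..l} \<subseteq> hyp_plane \<and>
     (\<forall>s\<in>{0..l}. \<forall>t\<in>{0..l}. hyp_dist (\<gamma> s) (\<gamma> t) = \<bar>s - t\<bar>)"

definition geod_convex :: "(real^2) set \<Rightarrow> bool" where
  "geod_convex S \<longleftrightarrow> S \<subseteq> hyp_plane \<and>
     (\<forall>\<gamma> l. hyp_geodesic \<gamma> l \<and> \<gamma> 0 \<in> S \<and> \<gamma> l \<in> S \<longrightarrow> \<gamma> ` {0..l} \<subseteq> S)"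

definition hyp_convex_body :: "(real^2) set \<Rightarrow> bool" where
  "hyp_convex_body K \<longleftrightarrow> compact K \<and> geod_convex K \<and> interior K \<noteq> {}"

definition illumination_body :: "real \<Rightarrow> (real^2) set \<Rightarrow> (real^2) set" where
  "illumination_body \<delta> K =
     {x \<in> hyp_plane. emeasure hyp_area ((geod_convex hull ({x} \<union> K)) - K) \<le> ennreal \<delta>}"

end

theory Submission imports Defs begin

text \<open>
  In the Klein model geodesics are straight segments, so a set of points of the disc is geodesically
  convex exactly if it is convex, and geodesic hulls are convex hulls (\<open>geod_convex_iff_convex\<close>,
  \<open>geod_convex_hull_eq\<close>). The claim is therefore that the area of \<open>conv({x} \<union> K) - K\<close> is a quasiconvex
  function of \<open>x\<close> on the disc.

  A supremum of quasiconvex functions is quasiconvex. So it is enough to find, for each \<open>y\<close>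
  outside \<open>K\<close>, a lower bound of the area function that is exact at \<open>y\<close> and quasiconvex. Let \<open>p\<close> and
  \<open>q\<close> be points where the two tangents from \<open>y\<close> touch \<open>K\<close>, and let \<open>H\<close> be the side of the line \<open>pq\<close>
  on which \<open>y\<close> lies. For \<open>x\<close> in \<open>H\<close> the triangle \<open>xpq\<close> lies in \<open>conv({x} \<union> K)\<close>, and it meets \<open>K\<close> only
  inside \<open>K \<inter> H\<close>; hence the area at \<open>x\<close> is at least \<open>area(xpq) - area(K \<inter> H)\<close>. At \<open>x = y\<close> this is an
  equality, because the tangents confine \<open>K \<inter> H\<close> to the triangle \<open>ypq\<close> and every point of the hull
  outside that triangle is already in \<open>K\<close>.

  This reduces everything to triangles with the fixed base \<open>pq\<close>. Their area \<open>A\<close> has the closed form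
  \<open>tan(A/2) = N(x) / D(x)\<close> (\<open>hyp_area_triangle\<close>), where, up to positive factors that do not depend on
  \<open>x\<close>, the numerator is the Euclidean area of the triangle and thus affine in \<open>x\<close>, while the
  denominator is a sum of an affine function and of a positive multiple of \<open>sqrt(1 - |x|^2)\<close>, hence
  concave and positive. A quotient of this kind is quasiconvex where its numerator is positive
  (\<open>orient_tri_den_quasiconvex\<close>), and the inverse tangent is increasing. On a segment through \<open>y\<close>
  one of the two end points therefore lies in \<open>H\<close> and has at least as large a triangle as \<open>y\<close>,
  which is all that the comparison requires.
\<close>

section \<open>The Lorentz product in the Klein disc\<close>

text \<open>
  The point \<open>x\<close> of the disc stands for the future timelike ray through \<open>(1, x)\<close>. On these vectors
  \<open>lor\<close> is minus the Lorentz product and \<open>lnorm\<close> the Lorentz length, so that \<open>(1, x) / lnorm x\<close>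
  is the representative of \<open>x\<close> on the hyperboloid.
\<close>

definition lor :: "real^2 \<Rightarrow> real^2 \<Rightarrow> real" where
  "lor x y = 1 - x \<bullet> y"

definition lnorm :: "real^2 \<Rightarrow> real" where
  "lnorm x = sqrt (lor x x)"

lemma lor_commute: "lor x y = lor y x"
  by (simp add: lor_def inner_commute)

lemma lor_comb_left:
  assumes "u + v = 1"
  shows "lor (u *\<^sub>R x + v *\<^sub>R y) z = u * lor x z + v * lor y z"
proof -
  have "v = 1 - u" using assms by simp
  then show ?thesis by (simp add: lor_def inner_add_left algebra_simps)
qed

lemma lor_comb_right:
  "u + v = 1 \<Longrightarrow> lor z (u *\<^sub>R x + v *\<^sub>R y) = u * lor z x + v * lor z y"
  using lor_comb_left[of u v x y z] by (simp add: lor_commute)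

lemma lor_self_pos:
  assumes "x \<in> hyp_plane" shows "lor x x > 0"
proof -
  have "(norm x)\<^sup>2 < 1"
    using assms by (simp add: hyp_plane_def abs_square_less_1)
  then show ?thesis by (simp add: lor_def dot_square_norm)
qed

lemma lor_pos:
  assumes "x \<in> hyp_plane" "y \<in> hyp_plane" shows "lor x y > 0"
proof -
  have "x \<bullet> y \<le> norm x * norm y" by (rule norm_cauchy_schwarz)
  also have "\<dots> < 1"
    using assms mult_left_le[of "norm y" "norm x"] by (simp add: hyp_plane_def)
  finally show ?thesis by (simp add: lor_def)
qed

lemma lnorm_pos: "x \<in> hyp_plane \<Longrightarrow> lnorm x > 0"
  by (simp add: lnorm_def lor_self_pos)

lemma lnorm_sq: "x \<in> hyp_plane \<Longrightarrow> (lnorm x)\<^sup>2 = lor x x"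
  by (simp add: lnorm_def lor_self_pos less_imp_le)

lemma lor_mult_self:
  "(lor x y)\<^sup>2 - lor x x * lor y y = (norm (x - y))\<^sup>2 - (x$1 * y$2 - x$2 * y$1)\<^sup>2"
  unfolding power2_norm_eq_inner lor_def inner_vec_def sum_2
  by (simp add: algebra_simps power2_eq_square)

lemma convex_hyp_plane: "convex hyp_plane"
  by (simp add: hyp_plane_def convex_ball)

text \<open>
  The reversed Cauchy-Schwarz inequality for timelike vectors. Its strictness is what makes
  hyperbolic distance separate points.
\<close>

lemma lnorm_mult_less_lor:
  assumes "x \<in> hyp_plane" "y \<in> hyp_plane" "x \<noteq> y"
  shows "lnorm x * lnorm y < lor x y"
proof -
  have "x$1 * y$2 - x$2 * y$1 = (x$1 - y$1) * y$2 - (x$2 - y$2) * y$1"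
    by (simp add: algebra_simps)
  moreover have "((x$1 - y$1) * y$2 - (x$2 - y$2) * y$1)\<^sup>2 \<le> (norm (x - y))\<^sup>2 * (norm y)\<^sup>2"
  proof -
    have "(norm (x - y))\<^sup>2 * (norm y)\<^sup>2 - ((x$1 - y$1) * y$2 - (x$2 - y$2) * y$1)\<^sup>2
       = ((x$1 - y$1) * y$1 + (x$2 - y$2) * y$2)\<^sup>2"
      unfolding power2_norm_eq_inner inner_vec_def sum_2
      by (simp add: algebra_simps power2_eq_square)
    then show ?thesis by (smt (verit) zero_le_power2)
  qed
  moreover have "(norm (x - y))\<^sup>2 * (norm y)\<^sup>2 < (norm (x - y))\<^sup>2"
    using assms by (simp add: hyp_plane_def abs_square_less_1)
  ultimately have "lor x x * lor y y < (lor x y)\<^sup>2"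
    using lor_mult_self[of x y] by simp
  then have "(lnorm x * lnorm y)\<^sup>2 < (lor x y)\<^sup>2"
    by (simp add: power_mult_distrib lnorm_sq assms)
  then show ?thesis
    using lor_pos[OF assms(1,2)] by (meson less_eq_real_def power_less_imp_less_base)
qed

lemma lnorm_mult_le_lor:
  assumes "x \<in> hyp_plane" "y \<in> hyp_plane"
  shows "lnorm x * lnorm y \<le> lor x y"
  using lnorm_mult_less_lor[OF assms] lnorm_sq[OF assms(1)]
  by (cases "x = y") (auto simp: power2_eq_square)

lemma hyp_dist_lor: "hyp_dist x y = arcosh (lor x y / (lnorm x * lnorm y))"
  by (simp add: hyp_dist_def lor_def lnorm_def dot_square_norm)

lemma cosh_hyp_dist:
  assumes "x \<in> hyp_plane" "y \<in> hyp_plane"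
  shows "lor x y = cosh (hyp_dist x y) * (lnorm x * lnorm y)"
proof -
  have "lor x y / (lnorm x * lnorm y) \<ge> 1"
    using lnorm_mult_le_lor[OF assms] lnorm_pos assms by (simp add: field_simps)
  then show ?thesis using lnorm_pos[OF assms(1)] lnorm_pos[OF assms(2)] by (simp add: hyp_dist_lor)
qed

lemma hyp_dist_eqI:
  assumes "x \<in> hyp_plane" "y \<in> hyp_plane" "lor x y = cosh d * (lnorm x * lnorm y)" "d \<ge> 0"
  shows "hyp_dist x y = d"
  using assms lnorm_pos[of x] lnorm_pos[of y] by (simp add: hyp_dist_lor arcosh_cosh_real)

lemma hyp_dist_nonneg:
  assumes "x \<in> hyp_plane" "y \<in> hyp_plane" shows "hyp_dist x y \<ge> 0"
  using lnorm_mult_le_lor[OF assms] lnorm_pos assms by (simp add: hyp_dist_lor)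

lemma hyp_dist_pos:
  assumes "x \<in> hyp_plane" "y \<in> hyp_plane" "x \<noteq> y" shows "hyp_dist x y > 0"
proof -
  have "hyp_dist x y \<noteq> 0"
    using cosh_hyp_dist[OF assms(1,2)] lnorm_mult_less_lor[OF assms] by auto
  with hyp_dist_nonneg[OF assms(1,2)] show ?thesis by simp
qed

section \<open>Geodesics are straight segments\<close>

lemma sinh_cosh_split: "sinh (l - t) * cosh t + sinh t * cosh (l - t) = sinh (l::real)"
  using sinh_add[of "l - t" t] by (simp add: algebra_simps)

text \<open>
  On the hyperboloid the geodesic of length \<open>l\<close> from \<open>A = (1, a) / lnorm a\<close> to \<open>B = (1, b) / lnorm b\<close>
  is \<open>(sinh (l - t) A + sinh t B) / sinh l\<close>. The next three definitions are its central projection to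
  the disc: \<open>geodesic_scale\<close> is the first coordinate of \<open>sinh (l - t) A + sinh t B\<close>, by which one has
  to divide, and \<open>geodesic_weight\<close> is the resulting barycentric coordinate of \<open>b\<close>.
\<close>

definition geodesic_scale :: "real^2 \<Rightarrow> real^2 \<Rightarrow> real \<Rightarrow> real \<Rightarrow> real" where
  "geodesic_scale a b l t = sinh (l - t) / lnorm a + sinh t / lnorm b"

definition geodesic_weight :: "real^2 \<Rightarrow> real^2 \<Rightarrow> real \<Rightarrow> real \<Rightarrow> real" where
  "geodesic_weight a b l t =
     sinh t / lnorm b / geodesic_scale a b l t"

definition geodesic_point :: "real^2 \<Rightarrow> real^2 \<Rightarrow> real \<Rightarrow> real \<Rightarrow> real^2" where
  "geodesic_point a b l t =
     (1 - geodesic_weight a b l t) *\<^sub>R a + geodesic_weight a b l t *\<^sub>R b"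

context
  fixes a b :: "real^2" and l :: real
  assumes ab: "a \<in> hyp_plane" "b \<in> hyp_plane" "a \<noteq> b" and l: "l = hyp_dist a b"
begin

lemma l_pos: "l > 0" using hyp_dist_pos[OF ab] l by simp

lemma geodesic_scale_pos:
  assumes "t \<in> {0..l}" shows "geodesic_scale a b l t > 0"
proof (cases "t = 0")
  case True
  then show ?thesis using l_pos lnorm_pos ab by (simp add: geodesic_scale_def)
next
  case False
  then show ?thesis using assms lnorm_pos[OF ab(1)] lnorm_pos[OF ab(2)]
    by (simp add: geodesic_scale_def add_nonneg_pos)
qed

lemma geodesic_weight_bounds:
  assumes "t \<in> {0..l}" shows "geodesic_weight a b l t \<in> {0..1}"
proof -
  have "sinh (l - t) / lnorm a \<ge> 0" "sinh t / lnorm b \<ge> 0"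
    using assms lnorm_pos[OF ab(1)] lnorm_pos[OF ab(2)] by simp_all
  then have "0 \<le> sinh t / lnorm b" "sinh t / lnorm b \<le> geodesic_scale a b l t"
    by (simp_all add: geodesic_scale_def)
  then show ?thesis
    using geodesic_scale_pos[OF assms] unfolding geodesic_weight_def
    by (simp del: divide_divide_eq_left)
qed

lemma geodesic_point_in_segment:
  assumes "t \<in> {0..l}" shows "geodesic_point a b l t \<in> closed_segment a b"
  using geodesic_weight_bounds[OF assms] unfolding geodesic_point_def closed_segment_def by auto

lemma geodesic_point_in_plane:
  assumes "t \<in> {0..l}" shows "geodesic_point a b l t \<in> hyp_plane"
  using geodesic_point_in_segment[OF assms] ab convex_hyp_plane
  by (meson closed_segment_subset subsetD)

lemma lor_geodesic_point:
  assumes "t \<in> {0..l}"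
  shows "geodesic_scale a b l t * lor (geodesic_point a b l t) z
     = sinh (l - t) / lnorm a * lor a z + sinh t / lnorm b * lor b z"
proof -
  let ?D = "geodesic_scale a b l t"
  have D: "?D \<noteq> 0" using geodesic_scale_pos[OF assms] by simp
  have w: "?D * geodesic_weight a b l t = sinh t / lnorm b"
    using D by (simp add: geodesic_weight_def)
  then have w': "?D * (1 - geodesic_weight a b l t) = sinh (l - t) / lnorm a"
    by (simp add: right_diff_distrib geodesic_scale_def)
  have "lor (geodesic_point a b l t) z =
     (1 - geodesic_weight a b l t) * lor a z + geodesic_weight a b l t * lor b z"
    unfolding geodesic_point_def by (subst lor_comb_left) simp_all
  then have "?D * lor (geodesic_point a b l t) z =
     (?D * (1 - geodesic_weight a b l t)) * lor a z + (?D * geodesic_weight a b l t) * lor b z"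
    by (simp only: distrib_left mult.assoc)
  then show ?thesis by (simp only: w w')
qed

text \<open>
  The Lorentz product of two points of the hyperboloid curve, before it is divided by
  \<open>(sinh l)\<^sup>2\<close>. That the result depends only on \<open>s - t\<close> says that \<open>t\<close> is arc length.
\<close>

lemma lor_geodesic_points:
  assumes "s \<in> {0..l}" "t \<in> {0..l}"
  shows "geodesic_scale a b l s * geodesic_scale a b l t
     * lor (geodesic_point a b l s) (geodesic_point a b l t) = cosh (s - t) * (sinh l)\<^sup>2"
    (is "?S * ?T * lor ?x ?y = _")
proof -
  note pos = lnorm_pos[OF ab(1)] lnorm_pos[OF ab(2)]
  have aa: "lor a a = lnorm a * lnorm a" and bb: "lor b b = lnorm b * lnorm b"
    using lnorm_sq ab by (simp_all add: power2_eq_square)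
  have ab': "lor a b = cosh l * (lnorm a * lnorm b)" using cosh_hyp_dist ab l by simp
  have "?T * lor ?y a = sinh (l - t) / lnorm a * lor a a + sinh t / lnorm b * lor b a"
    by (rule lor_geodesic_point[OF assms(2)])
  also have "\<dots> = lnorm a * (sinh (l - t) + sinh t * cosh l)"
    using pos by (simp add: aa lor_commute[of b a] ab' field_simps)
  finally have 1: "?T * lor a ?y / lnorm a = sinh (l - t) + sinh t * cosh l"
    using pos by (simp add: lor_commute[of a])
  have "?T * lor ?y b = sinh (l - t) / lnorm a * lor a b + sinh t / lnorm b * lor b b"
    by (rule lor_geodesic_point[OF assms(2)])
  also have "\<dots> = lnorm b * (sinh (l - t) * cosh l + sinh t)"
    using pos by (simp add: bb ab' field_simps)
  finally have 2: "?T * lor b ?y / lnorm b = sinh (l - t) * cosh l + sinh t"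
    using pos by (simp add: lor_commute[of b])
  have "?S * ?T * lor ?x ?y = ?T * (?S * lor ?x ?y)" by simp
  also have "\<dots> = sinh (l - s) * (?T * lor a ?y / lnorm a) + sinh s * (?T * lor b ?y / lnorm b)"
    unfolding lor_geodesic_point[OF assms(1)] by (simp add: distrib_left mult.assoc mult.left_commute)
  also have "\<dots> = sinh (l - s) * (sinh (l - t) + sinh t * cosh l) + sinh s * (sinh (l - t) * cosh l + sinh t)"
    by (simp only: 1 2)
  also have "\<dots> = cosh (s - t) * (sinh l)\<^sup>2"
  proof -
    have "sinh (l - s) * (sinh (l - t) + sinh t * cosh l) + sinh s * (sinh (l - t) * cosh l + sinh t)
        = cosh s * cosh t * (sinh l)\<^sup>2 - sinh s * sinh t * ((cosh l)\<^sup>2 - 1)"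
      by (simp add: sinh_diff algebra_simps power2_eq_square)
    also have "\<dots> = cosh (s - t) * (sinh l)\<^sup>2"
      by (simp add: cosh_diff cosh_square_eq algebra_simps)
    finally show ?thesis .
  qed
  finally show ?thesis .
qed

lemma lnorm_geodesic_point:
  assumes "t \<in> {0..l}"
  shows "geodesic_scale a b l t * lnorm (geodesic_point a b l t) = sinh l"
    (is "?T * ?n = _")
proof (rule power2_eq_imp_eq)
  have "(?T * ?n)\<^sup>2 = ?T * ?T * ?n\<^sup>2"
    by (simp only: power2_eq_square mult_ac)
  also have "\<dots> = (sinh l)\<^sup>2"
    unfolding lnorm_sq[OF geodesic_point_in_plane[OF assms]] lor_geodesic_points[OF assms assms]
    by simp
  finally show "(?T * ?n)\<^sup>2 = (sinh l)\<^sup>2" .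
  show "0 \<le> ?T * ?n"
    using geodesic_scale_pos[OF assms] lnorm_pos[OF geodesic_point_in_plane[OF assms]] by simp
  show "0 \<le> sinh l" using l_pos by simp
qed

lemma hyp_geodesic_geodesic_point: "hyp_geodesic (geodesic_point a b l) l"
  unfolding hyp_geodesic_def
proof (intro conjI ballI)
  show "0 \<le> l" using l_pos by simp
  show "geodesic_point a b l ` {0..l} \<subseteq> hyp_plane" using geodesic_point_in_plane by auto
  fix s t assume st: "s \<in> {0..l}" "t \<in> {0..l}"
  let ?S = "geodesic_scale a b l s"
  let ?T = "geodesic_scale a b l t"
  have "?S * ?T * lor (geodesic_point a b l s) (geodesic_point a b l t)
     = cosh (s - t) * ((?S * lnorm (geodesic_point a b l s)) * (?T * lnorm (geodesic_point a b l t)))"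
    using lor_geodesic_points[OF st] lnorm_geodesic_point st by (simp add: power2_eq_square)
  also have "\<dots> = ?S * ?T *
      (cosh (s - t) * (lnorm (geodesic_point a b l s) * lnorm (geodesic_point a b l t)))"
    by (simp only: mult_ac)
  finally have "lor (geodesic_point a b l s) (geodesic_point a b l t)
     = cosh (s - t) * (lnorm (geodesic_point a b l s) * lnorm (geodesic_point a b l t))"
    using geodesic_scale_pos[OF st(1)] geodesic_scale_pos[OF st(2)]
    by (subst (asm) mult_left_cancel) auto
  then show "hyp_dist (geodesic_point a b l s) (geodesic_point a b l t) = \<bar>s - t\<bar>"
    using st geodesic_point_in_plane by (intro hyp_dist_eqI) (auto simp: abs_if cosh_minus[of "s - t", symmetric])
qed

lemma geodesic_point_ends: "geodesic_point a b l 0 = a" "geodesic_point a b l l = b"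
  using l_pos lnorm_pos[OF ab(2)] by (simp_all add: geodesic_point_def geodesic_weight_def geodesic_scale_def)

text \<open>
  The weight runs continuously from 0 to 1, so no point of the segment is skipped.
\<close>

lemma segment_subset_geodesic: "closed_segment a b \<subseteq> geodesic_point a b l ` {0..l}"
proof
  fix z assume "z \<in> closed_segment a b"
  then obtain u where u: "0 \<le> u" "u \<le> 1" "z = (1 - u) *\<^sub>R a + u *\<^sub>R b"
    unfolding closed_segment_def by auto
  have "continuous_on {0..l} (geodesic_scale a b l)"
    unfolding geodesic_scale_def using lnorm_pos[OF ab(1)] lnorm_pos[OF ab(2)]
    by (intro continuous_intros) auto
  moreover have "\<forall>t\<in>{0..l}. geodesic_scale a b l t \<noteq> 0"
    using geodesic_scale_pos by force
  ultimately have "continuous_on {0..l} (geodesic_weight a b l)"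
    unfolding geodesic_weight_def using lnorm_pos[OF ab(2)]
    by (intro continuous_intros) auto
  moreover have "geodesic_weight a b l 0 = 0" "geodesic_weight a b l l = 1"
    using l_pos lnorm_pos[OF ab(2)] by (simp_all add: geodesic_weight_def geodesic_scale_def)
  ultimately obtain t where "0 \<le> t" "t \<le> l" "geodesic_weight a b l t = u"
    using IVT'[of "geodesic_weight a b l" 0 u l] u l_pos by auto
  then show "z \<in> geodesic_point a b l ` {0..l}"
    using u(3) by (intro image_eqI[of _ _ t]) (auto simp: geodesic_point_def)
qed

text \<open>
  Equality in the triangle inequality: the two prescribed distances determine the Lorentz product of
  \<open>x\<close> with the point of the geodesic at time \<open>t\<close>, and it attains equality in Cauchy-Schwarz.
\<close>

lemma geodesic_point_unique:
  assumes "x \<in> hyp_plane" "hyp_dist a x = t" "hyp_dist x b = l - t"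
  shows "x = geodesic_point a b l t"
proof (rule ccontr)
  assume ne: "x \<noteq> geodesic_point a b l t"
  have t: "t \<in> {0..l}"
    using hyp_dist_nonneg[OF ab(1) assms(1)] hyp_dist_nonneg[OF assms(1) ab(2)] assms by simp
  let ?T = "geodesic_scale a b l t"
  let ?y = "geodesic_point a b l t"
  note pos = lnorm_pos[OF ab(1)] lnorm_pos[OF ab(2)]
  have "?T * lor ?y x = sinh (l - t) / lnorm a * lor a x + sinh t / lnorm b * lor b x"
    by (rule lor_geodesic_point[OF t])
  also have "\<dots> = lnorm x * (sinh (l - t) * cosh t + sinh t * cosh (l - t))"
    using cosh_hyp_dist[OF ab(1) assms(1)] cosh_hyp_dist[OF assms(1) ab(2)] assms pos
    by (simp add: lor_commute[of b] field_simps)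
  also have "\<dots> = lnorm x * (?T * lnorm ?y)"
    by (simp only: sinh_cosh_split lnorm_geodesic_point[OF t])
  finally have "lor x ?y = lnorm x * lnorm ?y"
    using geodesic_scale_pos[OF t] by (simp add: lor_commute[of x])
  then show False using lnorm_mult_less_lor[OF assms(1) geodesic_point_in_plane[OF t] ne] by simp
qed

end

lemma hyp_geodesic_subset_segment:
  assumes "hyp_geodesic \<gamma> l"
  shows "\<gamma> ` {0..l} \<subseteq> closed_segment (\<gamma> 0) (\<gamma> l)"
proof
  fix x assume "x \<in> \<gamma> ` {0..l}"
  then obtain t where t: "t \<in> {0..l}" "x = \<gamma> t" by auto
  have l: "l \<ge> 0" and plane: "\<gamma> 0 \<in> hyp_plane" "\<gamma> l \<in> hyp_plane" "x \<in> hyp_plane"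
    and d: "hyp_dist (\<gamma> 0) (\<gamma> l) = l" "hyp_dist (\<gamma> 0) x = t" "hyp_dist x (\<gamma> l) = l - t"
    using assms t unfolding hyp_geodesic_def by (auto simp: image_subset_iff)
  show "x \<in> closed_segment (\<gamma> 0) (\<gamma> l)"
  proof (cases "\<gamma> 0 = \<gamma> l")
    case True
    have "hyp_dist (\<gamma> l) (\<gamma> l) = 0"
      using assms l unfolding hyp_geodesic_def by auto
    then have "l = 0" using d(1) True by simp
    then show ?thesis using t by simp
  next
    case False
    then show ?thesis
      using geodesic_point_unique[OF plane(1,2) False d(1)[symmetric] plane(3) d(2,3)]
        geodesic_point_in_segment[OF plane(1,2) False d(1)[symmetric] t(1)] by simp
  qed
qed

proposition geod_convex_iff_convex: "geod_convex S \<longleftrightarrow> S \<subseteq> hyp_plane \<and> convex S"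
proof safe
  assume S: "geod_convex S"
  then show sub: "x \<in> S \<Longrightarrow> x \<in> hyp_plane" for x by (auto simp: geod_convex_def)
  show "convex S" unfolding convex_contains_segment
  proof (intro ballI)
    fix a b assume ab: "a \<in> S" "b \<in> S"
    show "closed_segment a b \<subseteq> S"
    proof (cases "a = b")
      case False
      note * = sub[OF ab(1)] sub[OF ab(2)] False refl[of "hyp_dist a b"]
      have "geodesic_point a b (hyp_dist a b) ` {0..hyp_dist a b} \<subseteq> S"
        using S ab hyp_geodesic_geodesic_point[OF *] geodesic_point_ends[OF *]
        unfolding geod_convex_def by simp
      then show ?thesis using segment_subset_geodesic[OF *] by blast
    qed (use ab in simp)
  qed
next
  assume "S \<subseteq> hyp_plane" "convex S"
  then show "geod_convex S"
    using hyp_geodesic_subset_segment closed_segment_subset unfolding geod_convex_def by blast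
qed

corollary geod_convex_hull_eq:
  assumes "S \<subseteq> hyp_plane"
  shows "geod_convex hull S = convex hull S"
proof (rule hull_unique)
  show "S \<subseteq> convex hull S" by (rule hull_subset)
  show "geod_convex (convex hull S)"
    using assms convex_hyp_plane by (simp add: geod_convex_iff_convex hull_minimal)
  show "convex hull S \<subseteq> T" if "S \<subseteq> T" "geod_convex T" for T
    using that by (simp add: geod_convex_iff_convex hull_minimal)
qed


section \<open>A closed form for the area of a triangle\<close>

definition cross2 :: "real^2 \<Rightarrow> real^2 \<Rightarrow> real" where
  "cross2 v w = v$1 * w$2 - v$2 * w$1"

definition orient :: "real^2 \<Rightarrow> real^2 \<Rightarrow> real^2 \<Rightarrow> real" where
  "orient p a b = cross2 (a - p) (b - p)"

text \<open>
  The denominator in the formula for the tangent of half the area of a hyperbolic triangle. For unit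
  vectors \<open>P\<close>, \<open>A\<close>, \<open>B\<close> on the hyperboloid that formula reads
  \<open>det (P, A, B) / (1 + \<langle>P, A\<rangle> + \<langle>A, B\<rangle> + \<langle>P, B\<rangle>)\<close>, the analogue of the formula for solid angles; here
  both parts are multiplied by the three Lorentz norms.
\<close>

definition tri_den :: "real^2 \<Rightarrow> real^2 \<Rightarrow> real^2 \<Rightarrow> real" where
  "tri_den p a b = lnorm p * lnorm a * lnorm b
     + lor p a * lnorm b + lor p b * lnorm a + lor a b * lnorm p"

lemma tri_den_pos:
  assumes "p \<in> hyp_plane" "a \<in> hyp_plane" "b \<in> hyp_plane"
  shows "tri_den p a b > 0"
  using assms unfolding tri_den_def
  by (intro add_pos_pos mult_pos_pos lnorm_pos lor_pos)

text \<open>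
  \<open>orient p a b\<close> is the determinant of the vectors \<open>(1, p)\<close>, \<open>(1, a)\<close>, \<open>(1, b)\<close>, so its square is their
  Gram determinant.
\<close>

lemma orient_sq_gram:
  "(orient p a b)\<^sup>2 = lor p p * lor a a * lor b b + 2 * lor p a * lor a b * lor p b
     - lor p p * (lor a b)\<^sup>2 - lor a a * (lor p b)\<^sup>2 - lor b b * (lor p a)\<^sup>2"
  unfolding orient_def cross2_def lor_def inner_vec_def sum_2
  by (simp add: algebra_simps power2_eq_square)

text \<open>
  The identity behind the area formula: it makes the derivative of the inverse tangent of
  \<open>orient p a b / tri_den p a b\<close> collapse to a single simple fraction.
\<close>

lemma tri_den_sq_plus_orient_sq:
  assumes "p \<in> hyp_plane" "a \<in> hyp_plane" "b \<in> hyp_plane"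
  shows "(tri_den p a b)\<^sup>2 + (orient p a b)\<^sup>2 =
    2 * (lnorm p * lnorm a + lor p a) * (lnorm p * lnorm b + lor p b) * (lnorm a * lnorm b + lor a b)"
  unfolding orient_sq_gram tri_den_def
  using assms by (simp add: lnorm_sq[symmetric] algebra_simps power2_eq_square)

definition line_pt :: "real^2 \<Rightarrow> real^2 \<Rightarrow> real \<Rightarrow> real^2" where
  "line_pt a b s = (1 - s) *\<^sub>R a + s *\<^sub>R b"

lemma line_pt_in_plane:
  assumes "a \<in> hyp_plane" "b \<in> hyp_plane" "s \<in> {0..1}"
  shows "line_pt a b s \<in> hyp_plane"
  using assms convexD[OF convex_hyp_plane assms(1,2), of "1 - s" s] by (simp add: line_pt_def)

lemma lor_line_pt: "lor c (line_pt a b s) = (1 - s) * lor c a + s * lor c b"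
  unfolding line_pt_def by (subst lor_comb_right) simp_all

lemma lor_line_pt_left: "lor (line_pt a b s) c = (1 - s) * lor a c + s * lor b c"
  using lor_line_pt[of c a b s] by (simp add: lor_commute)

lemma lor_line_pt_self:
  "lor (line_pt a b s) (line_pt a b s) = (1 - s)\<^sup>2 * lor a a + 2 * s * (1 - s) * lor a b + s\<^sup>2 * lor b b"
  by (subst lor_line_pt) (simp add: lor_commute[of "line_pt a b s"] lor_line_pt lor_commute[of b a]
      algebra_simps power2_eq_square)

lemma lnorm_line_pt_deriv:
  assumes "line_pt a b s \<in> hyp_plane"
  shows "((\<lambda>s. lnorm (line_pt a b s)) has_real_derivative
     (lor (line_pt a b s) b - lor (line_pt a b s) a) / lnorm (line_pt a b s)) (at s within S)"
proof -
  have "((\<lambda>s. lor (line_pt a b s) (line_pt a b s)) has_real_derivative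
     2 * (((1 - s) * lor b a + s * lor b b) - ((1 - s) * lor a a + s * lor a b))) (at s within S)"
    unfolding lor_line_pt_self
    by (auto intro!: derivative_eq_intros simp: lor_commute[of b a] algebra_simps)
  then have "((\<lambda>s. lor (line_pt a b s) (line_pt a b s)) has_real_derivative
     2 * (lor (line_pt a b s) b - lor (line_pt a b s) a)) (at s within S)"
    by (simp only: lor_commute[of "line_pt a b s" a] lor_commute[of "line_pt a b s" b] lor_line_pt)
  then have "((\<lambda>s. sqrt (lor (line_pt a b s) (line_pt a b s))) has_real_derivative
     inverse (sqrt (lor (line_pt a b s) (line_pt a b s))) / 2 *
     (2 * (lor (line_pt a b s) b - lor (line_pt a b s) a))) (at s within S)"
    by (rule DERIV_chain2[OF DERIV_real_sqrt, rotated]) (rule lor_self_pos[OF assms])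
  moreover have "inverse q / 2 * (2 * d) = d / q" for q d :: real
    by (simp add: field_simps)
  ultimately show ?thesis unfolding lnorm_def by metis
qed

lemma borel_measurable_lnorm [measurable]: "lnorm \<in> borel_measurable borel"
  unfolding lnorm_def[abs_def] lor_def by measurable

lemma borel_measurable_lor [measurable]:
  assumes [measurable]: "f \<in> borel_measurable M" "g \<in> borel_measurable M"
  shows "(\<lambda>x. lor (f x) (g x)) \<in> borel_measurable M"
  unfolding lor_def by measurable

lemma borel_measurable_line_pt [measurable]:
  assumes [measurable]: "f \<in> borel_measurable M" "g \<in> borel_measurable M"  "h \<in> borel_measurable M"
  shows "(\<lambda>x. line_pt (f x) (g x) (h x)) \<in> borel_measurable M"
  unfolding line_pt_def by measurable

text \<open>
  The triangle \<open>pab\<close> is swept out by the segments from \<open>p\<close> to the points \<open>x\<close> of the opposite side.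
  With \<open>r\<close> the fraction of the way from \<open>p\<close> to \<open>x\<close>, the Euclidean area element is proportional to
  \<open>r dr\<close>, and this is the integral of the hyperbolic density along one such segment. The
  antiderivative is elementary because \<open>(lnorm x)\<^sup>2\<close> is a quadratic polynomial along a line.
\<close>

lemma nn_integral_radial:
  assumes "p \<in> hyp_plane" "x \<in> hyp_plane" "p \<noteq> x"
  shows "(\<integral>\<^sup>+r. ennreal (r / lnorm (line_pt p x r) ^ 3) * indicator {0..1} r \<partial>lborel)
     = ennreal (1 / (lnorm x * (lor p x + lnorm p * lnorm x)))"
proof -
  define k where "k = (lor p x)\<^sup>2 - (lnorm p)\<^sup>2 * (lnorm x)\<^sup>2"
  have "(lnorm p * lnorm x)\<^sup>2 < (lor p x)\<^sup>2"
    using lnorm_mult_less_lor[OF assms] lnorm_pos assms by (intro power_strict_mono) (auto simp: less_imp_le)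
  then have k: "k > 0" by (simp add: k_def power_mult_distrib)
  \<comment> \<open>An antiderivative of \<open>r / Q\<close> to the power 3/2 for the quadratic \<open>Q = (lnorm (line_pt p x r))\<^sup>2\<close>; the discriminant of \<open>Q\<close> is \<open>4 * k\<close>.\<close>
  define F where "F r = lor p (line_pt p x r) / (k * lnorm (line_pt p x r))" for r
  have 1: "(\<integral>\<^sup>+r. ennreal (r / lnorm (line_pt p x r) ^ 3) * indicator {0..1} r \<partial>lborel)
     = ennreal (F 1 - F 0)"
  proof (rule nn_integral_FTC_Icc)
    show "(\<lambda>r. r / lnorm (line_pt p x r) ^ 3) \<in> borel_measurable borel" by measurable
    fix r :: real assume "r \<in> {0..1}"
    then have r: "0 \<le> r" "r \<le> 1" by auto
    then have y: "line_pt p x r \<in> hyp_plane" using assms by (intro line_pt_in_plane) auto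
    note n = lnorm_pos[OF y]
    show "0 \<le> r / lnorm (line_pt p x r) ^ 3" using r n by simp
    let ?m = "lor p (line_pt p x r)" and ?n = "lnorm (line_pt p x r)"
    let ?n' = "(lor (line_pt p x r) x - lor (line_pt p x r) p) / ?n"
    have "((\<lambda>r. lor p (line_pt p x r)) has_real_derivative lor p x - lor p p) (at r)"
      unfolding lor_line_pt by (auto intro!: derivative_eq_intros)
    then have "(F has_real_derivative
       ((lor p x - lor p p) * (k * ?n) - ?m * (k * ?n')) / ((k * ?n) * (k * ?n))) (at r)"
      unfolding F_def using k n
      by (intro DERIV_divide DERIV_cmult[OF lnorm_line_pt_deriv[OF y]]) auto
    also have "((lor p x - lor p p) * (k * ?n) - ?m * (k * ?n')) / ((k * ?n) * (k * ?n)) =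
       ((lor p x - lor p p) * ?n\<^sup>2 - ?m * (?n' * ?n)) / (k * ?n ^ 3)"
      using k n by (simp add: field_simps power2_eq_square power3_eq_cube)
    also have "?n' * ?n = lor (line_pt p x r) x - lor (line_pt p x r) p" using n by simp
    also have "(lor p x - lor p p) * ?n\<^sup>2 - ?m * (lor (line_pt p x r) x - lor (line_pt p x r) p) = r * k"
      unfolding lnorm_sq[OF y] lor_line_pt_self lor_commute[of "line_pt p x r"] lor_line_pt k_def
        lnorm_sq[OF assms(1)] lnorm_sq[OF assms(2)]
      by (simp add: lor_commute[of x p] algebra_simps power2_eq_square)
    also have "r * k / (k * ?n ^ 3) = r / ?n ^ 3" using k by simp
    finally show "(F has_real_derivative r / ?n ^ 3) (at r)" .
  qed simp
  have "F 1 - F 0 = (lor p x - lnorm p * lnorm x) / (k * lnorm x)"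
    using k lnorm_pos[OF assms(1)] lnorm_pos[OF assms(2)] lnorm_sq[OF assms(1)]
    by (simp add: F_def line_pt_def field_simps power2_eq_square)
  also have "k = (lor p x - lnorm p * lnorm x) * (lor p x + lnorm p * lnorm x)"
    by (simp add: k_def algebra_simps power2_eq_square)
  also have "(lor p x - lnorm p * lnorm x) / (\<dots> * lnorm x) = 1 / (lnorm x * (lor p x + lnorm p * lnorm x))"
    using lnorm_mult_less_lor[OF assms] by simp
  finally show ?thesis using 1 by simp
qed

text \<open>
  Moving \<open>y\<close> from \<open>a\<close> to \<open>b\<close>, twice the inverse tangent of \<open>orient p a y / tri_den p a y\<close> has as its
  derivative the radial integral over the segment from \<open>p\<close> to \<open>y\<close>.
\<close>

lemma nn_integral_angular:
  assumes "p \<in> hyp_plane" "a \<in> hyp_plane" "b \<in> hyp_plane" and N: "orient p a b \<ge> 0"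
  shows "(\<integral>\<^sup>+s. ennreal (orient p a b / (lnorm (line_pt a b s) *
            (lor p (line_pt a b s) + lnorm p * lnorm (line_pt a b s)))) * indicator {0..1} s \<partial>lborel)
     = ennreal (2 * arctan (orient p a b / tri_den p a b))"
proof -
  define N where "N = orient p a b"
  define F where "F s = 2 * arctan (N * s / tri_den p a (line_pt a b s))" for s
  have "(\<integral>\<^sup>+s. ennreal (N / (lnorm (line_pt a b s) *
            (lor p (line_pt a b s) + lnorm p * lnorm (line_pt a b s)))) * indicator {0..1} s \<partial>lborel)
     = ennreal (F 1 - F 0)"
  proof (rule nn_integral_FTC_Icc)
    show "(\<lambda>s. N / (lnorm (line_pt a b s) *
        (lor p (line_pt a b s) + lnorm p * lnorm (line_pt a b s)))) \<in> borel_measurable borel"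
      by measurable
    fix s :: real assume "s \<in> {0..1}"
    then have s: "0 \<le> s" "s \<le> 1" by auto
    define y where "y = line_pt a b s"
    have y: "y \<in> hyp_plane" unfolding y_def using assms s by (intro line_pt_in_plane) auto
    note n = lnorm_pos[OF y] lor_pos[OF assms(1) y] lnorm_pos[OF assms(1)] lnorm_pos[OF assms(2)]
      lor_pos[OF assms(1,2)] lor_pos[OF assms(2) y]
    show "0 \<le> N / (lnorm (line_pt a b s) * (lor p (line_pt a b s) + lnorm p * lnorm (line_pt a b s)))"
      using n N by (simp add: y_def N_def)
    define k where "k = lnorm p * lnorm a + lor p a"
    define n' where "n' = (lor y b - lor y a) / lnorm y"
    define d where "d = tri_den p a y"
    define d' where "d' = k * n' + (lor p b - lor p a) * lnorm a + (lor a b - lor a a) * lnorm p"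
    have d: "d > 0" unfolding d_def using assms y by (intro tri_den_pos)
    have "((\<lambda>s. lor p (line_pt a b s)) has_real_derivative lor p b - lor p a) (at s)"
      "((\<lambda>s. lor a (line_pt a b s)) has_real_derivative lor a b - lor a a) (at s)"
      unfolding lor_line_pt by (auto intro!: derivative_eq_intros)
    moreover have "((\<lambda>s. lnorm (line_pt a b s)) has_real_derivative n') (at s)"
      using lnorm_line_pt_deriv[of a b s] y by (simp add: y_def n'_def)
    ultimately have "((\<lambda>s. tri_den p a (line_pt a b s)) has_real_derivative d') (at s)"
      unfolding tri_den_def d'_def k_def by (auto intro!: derivative_eq_intros simp: algebra_simps)
    then have "((\<lambda>s. N * s / tri_den p a (line_pt a b s)) has_real_derivative
       (N * d - N * s * d') / (d * d)) (at s)"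
      using d unfolding d_def y_def by (auto intro!: derivative_eq_intros)
    then have "(F has_real_derivative 2 * (inverse (1 + (N * s / d)\<^sup>2) * ((N * d - N * s * d') / (d * d))))
       (at s)"
      unfolding F_def d_def y_def by (intro DERIV_cmult DERIV_chain2[OF DERIV_arctan]) auto
    also have "2 * (inverse (1 + (N * s / d)\<^sup>2) * ((N * d - N * s * d') / (d * d))) =
        2 * N * (d - s * d') / (d\<^sup>2 + (N * s)\<^sup>2)"
    proof -
      have "inverse (1 + (N * s / d)\<^sup>2) = d\<^sup>2 / (d\<^sup>2 + (N * s)\<^sup>2)"
        using d by (simp add: divide_simps power_divide)
      moreover have "d\<^sup>2 / E * (Y / (d * d)) = Y / E" for E Y
        using d by (simp add: power2_eq_square)
      ultimately show ?thesis by (simp only:) (simp add: right_diff_distrib mult.assoc)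
    qed
    also have "N * s = orient p a y"
      by (simp add: N_def y_def line_pt_def orient_def cross2_def algebra_simps)
    also have "d\<^sup>2 + (orient p a y)\<^sup>2 = 2 * k * (lnorm p * lnorm y + lor p y) * (lnorm a * lnorm y + lor a y)"
      unfolding d_def k_def using assms y by (intro tri_den_sq_plus_orient_sq)
    also have "d - s * d' = k * (lnorm a * lnorm y + lor a y) / lnorm y"
    proof -
      have "lnorm y * (lnorm y - s * n') = lor a y"
      proof -
        have "lnorm y * n' = lor y b - lor y a" using n by (simp add: n'_def)
        moreover have "lnorm y * (lnorm y - s * n') = (lnorm y)\<^sup>2 - s * (lnorm y * n')"
          by (simp add: algebra_simps power2_eq_square)
        ultimately have "lnorm y * (lnorm y - s * n') = lor y y - s * (lor y b - lor y a)"
          by (simp only: lnorm_sq[OF y])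
        also have "lor y y = (1 - s) * lor y a + s * lor y b"
          using lor_line_pt[of y a b s] by (simp add: y_def)
        finally show ?thesis by (simp add: algebra_simps lor_commute[of a y])
      qed
      then have "lnorm y - s * n' = lor a y / lnorm y" using n by (simp add: field_simps)
      moreover have "d - s * d' = k * (lnorm y - s * n') + k * lnorm a"
        by (simp add: d_def d'_def tri_den_def k_def y_def lor_line_pt
            lnorm_sq[OF assms(2), symmetric] power2_eq_square algebra_simps)
      ultimately have "d - s * d' = k * (lor a y / lnorm y) + k * lnorm a" by (simp only:)
      then show ?thesis using n by (simp add: field_simps)
    qed
    also have "2 * N * (k * (lnorm a * lnorm y + lor a y) / lnorm y) /
        (2 * k * (lnorm p * lnorm y + lor p y) * (lnorm a * lnorm y + lor a y))
      = N / (lnorm y * (lor p y + lnorm p * lnorm y))"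
    proof -
      have "k > 0" "lnorm a * lnorm y + lor a y > 0" using n by (simp_all add: k_def add_pos_pos)
      then show ?thesis using n by (simp add: add.commute)
    qed
    finally show "(F has_real_derivative N / (lnorm (line_pt a b s) *
        (lor p (line_pt a b s) + lnorm p * lnorm (line_pt a b s)))) (at s)"
      unfolding y_def .
  qed simp
  then show ?thesis by (simp add: F_def N_def line_pt_def)
qed


section \<open>Area in coordinates adapted to a triangle\<close>

text \<open>
  This carries Fubini's theorem over from pairs to vectors with two components.
\<close>

lemma lborel_vec2:
  "(lborel :: (real^2) measure) =
     distr (lborel \<Otimes>\<^sub>M lborel) borel (\<lambda>q. fst q *\<^sub>R axis 1 1 + snd q *\<^sub>R axis 2 1)"
    (is "_ = distr _ _ ?f")
proof (rule lborel_eqI)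
  fix l u :: "real^2"
  assume le: "\<And>b. b \<in> Basis \<Longrightarrow> l \<bullet> b \<le> u \<bullet> b"
  have le': "l $ i \<le> u $ i" for i
    using le[of "axis i 1"] by (simp add: inner_axis axis_in_Basis_iff)
  have "?f -` box l u \<inter> space (lborel \<Otimes>\<^sub>M lborel) = {l$1<..<u$1} \<times> {l$2<..<u$2}"
    by (auto simp: mem_box_cart forall_2 axis_def space_pair_measure)
  then have "emeasure (distr (lborel \<Otimes>\<^sub>M lborel) borel ?f) (box l u) =
      emeasure (lborel \<Otimes>\<^sub>M lborel) ({l$1<..<u$1} \<times> {l$2<..<u$2})"
    by (subst emeasure_distr) auto
  also have "\<dots> = ennreal ((u$1 - l$1) * (u$2 - l$2))"
    using le' by (subst lborel.emeasure_pair_measure_Times) (auto simp: ennreal_mult)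
  also have "(u$1 - l$1) * (u$2 - l$2) = (\<Prod>b\<in>Basis. (u - l) \<bullet> b)"
  proof -
    have Basis_2: "(Basis :: (real^2) set) = {axis 1 1, axis 2 1}"
      by (auto simp: Basis_vec_def UNIV_2)
    show ?thesis unfolding Basis_2 by (simp add: inner_axis axis_eq_axis)
  qed
  finally show "emeasure (distr (lborel \<Otimes>\<^sub>M lborel) borel ?f) (box l u) = (\<Prod>b\<in>Basis. (u - l) \<bullet> b)" .
qed simp

lemma nn_integral_vec2:
  fixes F :: "real^2 \<Rightarrow> ennreal"
  assumes [measurable]: "F \<in> borel_measurable borel"
  shows "(\<integral>\<^sup>+z. F z \<partial>lborel) =
     (\<integral>\<^sup>+s. \<integral>\<^sup>+r. F (r *\<^sub>R axis 1 1 + s *\<^sub>R axis 2 1) \<partial>lborel \<partial>lborel)"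
  by (subst lborel_vec2, subst nn_integral_distr, simp, simp,
      subst lborel_pair.nn_integral_snd[symmetric]) simp_all

lemma emeasure_hyp_area:
  assumes [measurable]: "T \<in> sets borel" and "T \<subseteq> hyp_plane"
  shows "emeasure hyp_area T = (\<integral>\<^sup>+x. ennreal (1 / lnorm x ^ 3) * indicator T x \<partial>lborel)"
proof -
  have [measurable]: "hyp_plane \<in> sets borel" by (simp add: hyp_plane_def)
  have "emeasure hyp_area T = (\<integral>\<^sup>+x. indicator hyp_plane x *
      ennreal (1 / sqrt ((1 - (norm x)\<^sup>2) ^ 3)) * indicator T x \<partial>lborel)"
    unfolding hyp_area_def by (rule emeasure_density) measurable
  also have "\<dots> = (\<integral>\<^sup>+x. ennreal (1 / lnorm x ^ 3) * indicator T x \<partial>lborel)"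
    using assms(2) by (intro nn_integral_cong)
      (auto simp: lnorm_def lor_def dot_square_norm real_sqrt_power split: split_indicator)
  finally show ?thesis .
qed

text \<open>
  Parameters for the sweep of a triangle: the first component is the fraction of the way from the
  apex to the opposite side, the second the position on that side. The value 0 of the first one is
  left out, since it would send a whole segment to the apex; the triangle loses only that point.
\<close>

definition tri_coords :: "(real^2) set" where
  "tri_coords = {z. 0 < z$1 \<and> z$1 \<le> 1 \<and> 0 \<le> z$2 \<and> z$2 \<le> 1}"

lemma borel_tri_coords [measurable]: "tri_coords \<in> sets borel"
  unfolding tri_coords_def by measurable

definition tri_map :: "real^2 \<Rightarrow> real^2 \<Rightarrow> real^2 \<Rightarrow> real^2 \<Rightarrow> real^2" where
  "tri_map p a b z = line_pt p (line_pt a b (z$2)) (z$1)"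

lemma tri_map_alt:
  "tri_map p a b z = p + (z$1 * (1 - z$2)) *\<^sub>R (a - p) + (z$1 * z$2) *\<^sub>R (b - p)"
  by (simp add: tri_map_def line_pt_def algebra_simps scaleR_diff_left)

text \<open>
  Oriented areas are barycentric coordinates. This gives the injectivity of the parametrisation here,
  and the position of a point relative to the tangents from \<open>x\<close> and to the chord \<open>pq\<close> further on.
\<close>

lemma orient_decompose:
  assumes "y = p + u *\<^sub>R (a - p) + v *\<^sub>R (b - p)"
  shows "orient p y b = u * orient p a b" "orient p a y = v * orient p a b"
    "orient y a b = (1 - u - v) * orient p a b"
  unfolding assms orient_def cross2_def by (simp_all add: algebra_simps)

lemma inj_on_tri_map:
  assumes "orient p a b \<noteq> 0"
  shows "inj_on (tri_map p a b) tri_coords"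
proof (rule inj_onI)
  fix z w assume zw: "z \<in> tri_coords" "w \<in> tri_coords" and eq: "tri_map p a b z = tri_map p a b w"
  have "z$1 * (1 - z$2) = w$1 * (1 - w$2)" "z$1 * z$2 = w$1 * w$2"
    using orient_decompose(1,2)[OF tri_map_alt[of p a b z]] orient_decompose(1,2)[OF tri_map_alt[of p a b w]]
      eq assms by simp_all
  then have "z$1 = w$1" "z$1 * z$2 = w$1 * w$2" by (simp_all add: right_diff_distrib)
  then show "z = w" using zw by (simp add: vec_eq_iff forall_2 tri_coords_def)
qed

lemma tri_map_image: "insert p (tri_map p a b ` tri_coords) = convex hull {p, a, b}"
proof (rule set_eqI)
  fix y
  show "y \<in> insert p (tri_map p a b ` tri_coords) \<longleftrightarrow> y \<in> convex hull {p, a, b}"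
  proof
    assume "y \<in> insert p (tri_map p a b ` tri_coords)"
    then consider "y = p" | z where "z \<in> tri_coords" "y = tri_map p a b z" by auto
    then show "y \<in> convex hull {p, a, b}"
    proof cases
      case 1 then show ?thesis by (simp add: hull_inc)
    next
      case 2
      have "z$1 * (1 - z$2) + z$1 * z$2 \<le> 1" "0 \<le> z$1 * (1 - z$2)" "0 \<le> z$1 * z$2"
        using 2(1) by (simp_all add: tri_coords_def right_diff_distrib mult_left_le)
      then show ?thesis
        unfolding convex_hull_3_alt using 2(2) tri_map_alt[of p a b z] by blast
    qed
  next
    assume "y \<in> convex hull {p, a, b}"
    then obtain u v where uv: "y = p + u *\<^sub>R (a - p) + v *\<^sub>R (b - p)" "0 \<le> u" "0 \<le> v" "u + v \<le> 1"
      unfolding convex_hull_3_alt by auto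
    show "y \<in> insert p (tri_map p a b ` tri_coords)"
    proof (cases "u + v = 0")
      case True
      then have "u = 0" "v = 0" using uv by simp_all
      then show ?thesis using uv by simp
    next
      case False
      define z :: "real^2" where "z = vector [u + v, v / (u + v)]"
      have z: "z$1 = u + v" "z$2 = v / (u + v)" by (simp_all add: z_def)
      have "z \<in> tri_coords" using False uv unfolding tri_coords_def mem_Collect_eq z by simp
      moreover have "z$1 * z$2 = v" "z$1 * (1 - z$2) = u"
        using False unfolding z by (simp_all add: right_diff_distrib)
      then have "y = tri_map p a b z" using uv(1) tri_map_alt[of p a b z] by simp
      ultimately show ?thesis by simp
    qed
  qed
qed

lemma tri_map_has_derivative:
  "(tri_map p a b has_derivative (\<lambda>h. h$1 *\<^sub>R (line_pt a b (z$2) - p) + h$2 *\<^sub>R (z$1 *\<^sub>R (b - a))))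
     (at z within S)"
proof -
  have eq: "tri_map p a b = (\<lambda>z. p + z$1 *\<^sub>R (a + z$2 *\<^sub>R (b - a) - p))"
    by (auto simp: tri_map_def line_pt_def algebra_simps)
  have c: "((\<lambda>z::real^2. z $ i) has_derivative (\<lambda>h. h $ i)) (at z within S)" for i
    by (rule bounded_linear_imp_has_derivative) (rule bounded_linear_vec_nth)
  show ?thesis unfolding eq
    by (rule has_derivative_eq_rhs, (rule derivative_intros c)+)
       (simp add: line_pt_def algebra_simps fun_eq_iff)
qed

lemma det_tri_map:
  "det (matrix (\<lambda>h::real^2. h$1 *\<^sub>R (line_pt a b (z$2) - p) + h$2 *\<^sub>R (z$1 *\<^sub>R (b - a))))
     = z$1 * orient p a b"
  by (simp add: det_2 matrix_def axis_def orient_def cross2_def line_pt_def algebra_simps)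

lemma borel_measurable_tri_map [measurable]: "tri_map p a b \<in> borel_measurable borel"
  unfolding tri_map_def[abs_def] by measurable

lemma nn_integral_tri_coords:
  assumes "p \<in> hyp_plane" "a \<in> hyp_plane" "b \<in> hyp_plane" and N: "orient p a b > 0"
  shows "(\<integral>\<^sup>+z. ennreal (z$1 * orient p a b / lnorm (tri_map p a b z) ^ 3) * indicator tri_coords z \<partial>lborel)
     = ennreal (2 * arctan (orient p a b / tri_den p a b))"
proof -
  define N where "N = orient p a b"
  have N0: "N > 0" using N by (simp add: N_def)
  let ?v = "\<lambda>r s. r *\<^sub>R axis 1 1 + s *\<^sub>R axis 2 1 :: real^2"
  have v: "?v r s $ 1 = r" "?v r s $ 2 = s" for r s by (simp_all add: axis_def)
  have "(\<integral>\<^sup>+z. ennreal (z$1 * N / lnorm (tri_map p a b z) ^ 3) * indicator tri_coords z \<partial>lborel) =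
      (\<integral>\<^sup>+s. \<integral>\<^sup>+r. ennreal (r * N / lnorm (line_pt p (line_pt a b s) r) ^ 3) *
          indicator tri_coords (?v r s) \<partial>lborel \<partial>lborel)"
    by (subst nn_integral_vec2, measurable) (simp only: v tri_map_def)
  also have "\<dots> = (\<integral>\<^sup>+s. ennreal (N / (lnorm (line_pt a b s) *
            (lor p (line_pt a b s) + lnorm p * lnorm (line_pt a b s)))) * indicator {0..1} s \<partial>lborel)"
  proof (rule nn_integral_cong)
    fix s :: real
    show "(\<integral>\<^sup>+r. ennreal (r * N / lnorm (line_pt p (line_pt a b s) r) ^ 3) *
          indicator tri_coords (?v r s) \<partial>lborel) =
        ennreal (N / (lnorm (line_pt a b s) *
            (lor p (line_pt a b s) + lnorm p * lnorm (line_pt a b s)))) * indicator {0..1} s"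
    proof (cases "s \<in> {0..1}")
      case False
      then have "indicator tri_coords (?v r s) = (0 :: ennreal)" for r
        unfolding tri_coords_def indicator_def by (simp only: v mem_Collect_eq) auto
      with False show ?thesis by simp
    next
      case True
      define y where "y = line_pt a b s"
      have y: "y \<in> hyp_plane" unfolding y_def using assms True by (intro line_pt_in_plane)
      have "orient p a y \<noteq> 0 \<or> orient p y b \<noteq> 0"
        using N0 orient_decompose(1,2)[of y p "1 - s" a s b]
        by (cases "s = 0") (simp_all add: y_def line_pt_def algebra_simps N_def)
      then have "p \<noteq> y" by (auto simp: orient_def cross2_def)
      have "(\<integral>\<^sup>+r. ennreal (r * N / lnorm (line_pt p y r) ^ 3) * indicator tri_coords (?v r s) \<partial>lborel)
        = (\<integral>\<^sup>+r. ennreal N * (ennreal (r / lnorm (line_pt p y r) ^ 3) * indicator {0..1} r) \<partial>lborel)"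
      proof (rule nn_integral_cong)
        fix r :: real
        have ind: "indicator tri_coords (?v r s) = (indicator {0<..1} r :: ennreal)"
          using True unfolding tri_coords_def indicator_def by (simp only: v mem_Collect_eq) auto
        show "ennreal (r * N / lnorm (line_pt p y r) ^ 3) * indicator tri_coords (?v r s) =
          ennreal N * (ennreal (r / lnorm (line_pt p y r) ^ 3) * indicator {0..1} r)"
        proof (cases "r \<in> {0<..1}")
          case True
          then have "line_pt p y r \<in> hyp_plane" using assms y by (intro line_pt_in_plane) auto
          from lnorm_pos[OF this] True N0 have "ennreal (r * N / lnorm (line_pt p y r) ^ 3) =
              ennreal N * ennreal (r / lnorm (line_pt p y r) ^ 3)"
            by (subst ennreal_mult[symmetric]) (simp_all add: mult.commute)
          with True show ?thesis unfolding ind by simp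
        next
          case False
          then show ?thesis unfolding ind by (auto simp: indicator_def)
        qed
      qed
      also have "\<dots> = ennreal N * ennreal (1 / (lnorm y * (lor p y + lnorm p * lnorm y)))"
        by (subst nn_integral_cmult, measurable) (simp only: nn_integral_radial[OF assms(1) y \<open>p \<noteq> y\<close>])
      also have "\<dots> = ennreal (N / (lnorm y * (lor p y + lnorm p * lnorm y)))"
        using N0 lnorm_pos[OF y] lnorm_pos[OF assms(1)] lor_pos[OF assms(1) y]
        by (subst ennreal_mult[symmetric]) simp_all
      finally show ?thesis using True by (simp add: y_def)
    qed
  qed
  also have "\<dots> = ennreal (2 * arctan (N / tri_den p a b))"
    unfolding N_def using assms by (intro nn_integral_angular) simp_all
  finally show ?thesis by (simp add: N_def)
qed

text \<open>
  Change of variables along the sweep, whose Jacobian determinant is \<open>r * orient p a b\<close>.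
\<close>

proposition hyp_area_triangle:
  assumes "p \<in> hyp_plane" "a \<in> hyp_plane" "b \<in> hyp_plane" and N: "orient p a b > 0"
  shows "emeasure hyp_area (convex hull {p, a, b}) = ennreal (2 * arctan (orient p a b / tri_den p a b))"
proof -
  define I where "I = 2 * arctan (orient p a b / tri_den p a b)"
  have I: "I \<ge> 0" unfolding I_def using N tri_den_pos[OF assms(1-3)] by simp
  let ?T = "convex hull {p, a, b}" and ?g = "tri_map p a b"
  let ?g' = "\<lambda>z h::real^2. h$1 *\<^sub>R (line_pt a b (z$2) - p) + h$2 *\<^sub>R (z$1 *\<^sub>R (b - a))"
  define w :: "real^2 \<Rightarrow> real" where "w x = 1 / lnorm x ^ 3" for x
  define h where "h z = z$1 * orient p a b * w (?g z)" for z
  have sub: "?T \<subseteq> hyp_plane"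
    using assms convex_hyp_plane by (intro hull_minimal) auto
  have w0: "w x \<ge> 0" if "x \<in> hyp_plane" for x using lnorm_pos[OF that] by (simp add: w_def)
  have g: "?g z \<in> ?T" if "z \<in> tri_coords" for z
    using tri_map_image[of p a b] that by blast
  have h0: "h z \<ge> 0" if "z \<in> tri_coords" for z
    using w0[OF subsetD[OF sub g[OF that]]] that N by (simp add: h_def tri_coords_def)
  have [measurable]: "h \<in> borel_measurable borel"
    unfolding h_def[abs_def] w_def by measurable
  have "((\<lambda>z. h z * indicator tri_coords z) has_integral I) UNIV"
  proof (rule nn_integral_has_integral)
    show "(\<integral>\<^sup>+z. ennreal (h z * indicator tri_coords z) \<partial>lborel) = ennreal I"
      using nn_integral_tri_coords[OF assms] unfolding I_def h_def w_def
      by (simp add: ennreal_mult' ennreal_indicator[symmetric] ennreal_mult''[symmetric])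
  qed (use I h0 in \<open>auto split: split_indicator\<close>)
  then have hI: "(h has_integral I) tri_coords"
    by (subst has_integral_restrict_UNIV[symmetric])
       (simp add: indicator_def of_bool_def if_distrib[of "(*) _"] cong: if_cong)
  then have "h absolutely_integrable_on tri_coords"
    using h0 by (intro nonnegative_absolutely_integrable_1) (auto simp: integrable_on_def)
  \<comment> \<open>The theorem on change of variables is about vector-valued integrands, hence the detour through \<open>real^1\<close>.\<close>
  then have "(\<lambda>z. h z *\<^sub>R (1::real^1)) absolutely_integrable_on tri_coords"
    by (rule absolutely_integrable_scaleR_right)
  moreover have "integral tri_coords (\<lambda>z. h z *\<^sub>R (1::real^1)) = I *\<^sub>R 1"
    by (rule integral_unique) (rule has_integral_scaleR_left[OF hI])
  moreover have jac: "h z *\<^sub>R (1::real^1) = \<bar>det (matrix (?g' z))\<bar> *\<^sub>R (w (?g z) *\<^sub>R 1)"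
    if "z \<in> tri_coords" for z
    using that N unfolding det_tri_map by (simp add: h_def tri_coords_def abs_mult)
  ultimately have "(\<lambda>z. \<bar>det (matrix (?g' z))\<bar> *\<^sub>R (w (?g z) *\<^sub>R (1::real^1))) absolutely_integrable_on tri_coords \<and>
      integral tri_coords (\<lambda>z. \<bar>det (matrix (?g' z))\<bar> *\<^sub>R (w (?g z) *\<^sub>R (1::real^1))) = I *\<^sub>R 1"
    using set_integrable_cong[OF refl refl, of tri_coords "\<lambda>z. h z *\<^sub>R (1::real^1)", OF jac]
      integral_cong[of tri_coords "\<lambda>z. h z *\<^sub>R (1::real^1)", OF jac] by (simp only:)
  then have "(\<lambda>x. w x *\<^sub>R (1::real^1)) absolutely_integrable_on (?g ` tri_coords) \<and>
      integral (?g ` tri_coords) (\<lambda>x. w x *\<^sub>R (1::real^1)) = I *\<^sub>R 1"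
    by (rule has_absolute_integral_change_of_variables[THEN iffD1, rotated 3])
      (use N in \<open>simp_all add: inj_on_tri_map tri_map_has_derivative del: scaleR_scaleR\<close>)
  then have "((\<lambda>x. w x *\<^sub>R (1::real^1)) has_integral I *\<^sub>R 1) (?g ` tri_coords)"
    using set_lebesgue_integral_eq_integral(1) by (metis integrable_integral)
  from has_integral_linear[OF this bounded_linear_vec_nth[of 1]]
  have "(w has_integral I) (?g ` tri_coords)" by (simp add: o_def)
  then have "(w has_integral I) ?T"
    unfolding tri_map_image[symmetric]
    by (rule has_integral_spike_set_eq[THEN iffD1, rotated 2]) (auto intro: negligible_subset[of "{p}"])
  then have "(\<integral>\<^sup>+x. ennreal (w x) * indicator ?T x \<partial>lborel) = ennreal I"
    using w0 sub by (intro nn_integral_has_integral_lebesgue') auto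
  then show ?thesis
    using sub by (subst emeasure_hyp_area)
      (auto simp: w_def I_def compact_imp_closed finite_imp_compact_convex_hull borel_closed)
qed


section \<open>Quasiconvexity of the area of a triangle in its apex\<close>

lemma lnorm_concave:
  assumes "a \<in> hyp_plane" "b \<in> hyp_plane" "s \<in> {0..1}"
  shows "(1 - s) * lnorm a + s * lnorm b \<le> lnorm (line_pt a b s)"
proof (rule power2_le_imp_le)
  have "2 * s * (1 - s) * (lnorm a * lnorm b) \<le> 2 * s * (1 - s) * lor a b"
    using lnorm_mult_le_lor[OF assms(1,2)] assms(3) by (intro mult_left_mono) auto
  moreover have "((1 - s) * lnorm a + s * lnorm b)\<^sup>2 =
      (1 - s)\<^sup>2 * (lnorm a)\<^sup>2 + 2 * s * (1 - s) * (lnorm a * lnorm b) + s\<^sup>2 * (lnorm b)\<^sup>2"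
    by (simp add: algebra_simps power2_eq_square)
  ultimately show "((1 - s) * lnorm a + s * lnorm b)\<^sup>2 \<le> (lnorm (line_pt a b s))\<^sup>2"
    unfolding lnorm_sq[OF line_pt_in_plane[OF assms]] lnorm_sq[OF assms(1)] lnorm_sq[OF assms(2)]
      lor_line_pt_self by linarith
  show "0 \<le> lnorm (line_pt a b s)"
    using lnorm_pos[OF line_pt_in_plane[OF assms]] by simp
qed

text \<open>
  As a function of the apex, \<open>tri_den\<close> is an affine function plus a positive multiple of \<open>lnorm\<close>.
\<close>

lemma tri_den_concave:
  assumes "a \<in> hyp_plane" "b \<in> hyp_plane" "s \<in> {0..1}" "p \<in> hyp_plane" "q \<in> hyp_plane"
  shows "(1 - s) * tri_den a p q + s * tri_den b p q \<le> tri_den (line_pt a b s) p q"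
proof -
  have "((1 - s) * lnorm a + s * lnorm b) * (lnorm p * lnorm q + lor p q)
      \<le> lnorm (line_pt a b s) * (lnorm p * lnorm q + lor p q)"
    using lnorm_concave[OF assms(1-3)] lnorm_pos[OF assms(4)] lnorm_pos[OF assms(5)] lor_pos[OF assms(4,5)]
    by (intro mult_right_mono) (auto simp: add_nonneg_nonneg)
  then show ?thesis
    unfolding tri_den_def lor_line_pt_left
    by (simp add: algebra_simps)
qed

lemma orient_line_pt:
  "orient (line_pt a b s) p q = (1 - s) * orient a p q + s * orient b p q"
  by (simp add: orient_def cross2_def line_pt_def algebra_simps)

text \<open>
  A quotient \<open>N / D\<close> with \<open>N\<close> affine and \<open>D\<close> concave and positive. Let \<open>c\<close> be its larger value at the
  ends; \<open>c > 0\<close>, since \<open>N\<close> is positive somewhere in between. So \<open>c D - N\<close> is concave, and being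
  nonnegative at the ends it is nonnegative in between. The end point with the larger quotient also lies on the positive side of the line \<open>pq\<close>, so that its quotient is
  the tangent of half an actual area, even if the other end lies beyond that line.
\<close>

lemma orient_tri_den_quasiconvex:
  assumes "a \<in> hyp_plane" "b \<in> hyp_plane" "s \<in> {0..1}" "p \<in> hyp_plane" "q \<in> hyp_plane"
    and pos: "orient (line_pt a b s) p q > 0"
  obtains x where "x \<in> {a, b}" "orient x p q > 0"
    "orient (line_pt a b s) p q / tri_den (line_pt a b s) p q \<le> orient x p q / tri_den x p q"
proof -
  define R where "R x = orient x p q / tri_den x p q" for x
  define x where "x = (if R a \<le> R b then b else a)"
  have x: "x \<in> {a, b}" "R a \<le> R x" "R b \<le> R x" by (auto simp: x_def)
  have den: "tri_den y p q > 0" if "y \<in> hyp_plane" for y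
    using that assms by (intro tri_den_pos)
  have eq: "orient y p q = R y * tri_den y p q" if "y \<in> hyp_plane" for y
    using den[OF that] by (simp add: R_def)
  let ?y = "line_pt a b s" and ?D = "(1 - s) * tri_den a p q + s * tri_den b p q"
  have y: "?y \<in> hyp_plane" by (rule line_pt_in_plane[OF assms(1-3)])
  have "orient ?y p q = (1 - s) * (R a * tri_den a p q) + s * (R b * tri_den b p q)"
    by (simp add: orient_line_pt eq assms(1,2))
  also have "\<dots> \<le> (1 - s) * (R x * tri_den a p q) + s * (R x * tri_den b p q)"
    using x(2,3) den[OF assms(1)] den[OF assms(2)] assms(3)
    by (intro add_mono mult_left_mono mult_right_mono) auto
  also have "\<dots> = R x * ?D" by (simp add: algebra_simps)
  finally have le: "orient ?y p q \<le> R x * ?D" .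
  have "?D \<ge> 0" using den[OF assms(1)] den[OF assms(2)] assms(3) by simp
  then have Rx: "R x > 0" using le pos by (smt (verit) mult_nonpos_nonneg)
  have "R x * ?D \<le> R x * tri_den ?y p q"
    using Rx tri_den_concave[OF assms(1-5)] by (intro mult_left_mono) auto
  then have "R ?y \<le> R x"
    using le den[OF y] by (simp add: R_def[of ?y] divide_le_eq)
  moreover have "orient x p q > 0"
    using eq[of x] den[of x] Rx x(1) assms(1,2) by auto
  ultimately show ?thesis using that[of x] x(1) by (simp add: R_def)
qed

section \<open>The hull seen from an outside point\<close>

lemma cross2_slope:
  "(u \<bullet> u) * cross2 v w = (u \<bullet> v) * cross2 u w - (u \<bullet> w) * cross2 u v"
  by (simp add: cross2_def inner_vec_def sum_2 algebra_simps)

text \<open>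
  Take \<open>u\<close> normal to a line separating \<open>x\<close> from \<open>K\<close>. The points of \<open>K\<close> are then seen from \<open>x\<close> with a finite
  slope relative to \<open>u\<close>, and the tangent points are those of extreme slope. If the extreme slopes
  agreed, \<open>K\<close> would lie on a line and have no interior.
\<close>

lemma exists_tangent_points:
  assumes "compact K" "convex K" "interior K \<noteq> {}" "x \<notin> K"
  obtains p q where "p \<in> K" "q \<in> K" "orient x p q > 0"
    "\<And>y. y \<in> K \<Longrightarrow> orient x p y \<ge> 0" "\<And>y. y \<in> K \<Longrightarrow> orient x y q \<ge> 0"
proof -
  obtain u c where u: "u \<bullet> x < c" "\<And>y. y \<in> K \<Longrightarrow> c < u \<bullet> y"
    using separating_hyperplane_closed_point[OF assms(2) compact_imp_closed[OF assms(1)] assms(4)] by auto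
  have up: "u \<bullet> (y - x) > 0" if "y \<in> K" for y
    using u(1) u(2)[OF that] by (simp add: inner_diff_right)
  have K: "K \<noteq> {}" using assms(3) interior_subset[of K] by auto
  then have "u \<noteq> 0" using up by force
  define f where "f y = cross2 u (y - x) / (u \<bullet> (y - x))" for y
  have "continuous_on K f"
    unfolding f_def cross2_def using up by (intro continuous_intros) (auto dest: up)
  then obtain p q where p: "p \<in> K" "\<And>y. y \<in> K \<Longrightarrow> f p \<le> f y" and q: "q \<in> K" "\<And>y. y \<in> K \<Longrightarrow> f y \<le> f q"
    using continuous_attains_inf[OF assms(1) K] continuous_attains_sup[OF assms(1) K] by metis
  have slope: "orient x y z = (u \<bullet> (y - x)) * (u \<bullet> (z - x)) / (u \<bullet> u) * (f z - f y)"
    if "y \<in> K" "z \<in> K" for y z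
  proof -
    let ?Y = "u \<bullet> (y - x)" and ?Z = "u \<bullet> (z - x)"
    have "?Y * ?Z * (f z - f y) = ?Y * cross2 u (z - x) - ?Z * cross2 u (y - x)"
      using up[OF that(1)] up[OF that(2)] by (simp add: f_def right_diff_distrib)
    then have "(u \<bullet> u) * orient x y z = ?Y * ?Z * (f z - f y)"
      unfolding orient_def cross2_slope by simp
    then show ?thesis using \<open>u \<noteq> 0\<close> by (simp add: eq_divide_eq mult.commute)
  qed
  have nonneg: "orient x y z \<ge> 0" if "y \<in> K" "z \<in> K" "f y \<le> f z" for y z
    unfolding slope[OF that(1,2)] using up[OF that(1)] up[OF that(2)] that(3)
    by (intro mult_nonneg_nonneg divide_nonneg_nonneg) auto
  have "orient x p q \<noteq> 0"
  proof
    assume "orient x p q = 0"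
    then have "f p = f q"
      using slope[OF p(1) q(1)] up[OF p(1)] up[OF q(1)] \<open>u \<noteq> 0\<close> by simp
    then have zero: "orient x p y = 0" if "y \<in> K" for y
      using p(2)[OF that] q(2)[OF that] slope[OF p(1) that] by simp
    define n :: "real^2" where "n = vector [- (p - x)$2, (p - x)$1]"
    have "p \<noteq> x" using p(1) assms(4) by auto
    then have "n \<noteq> 0" by (auto simp: n_def vec_eq_iff forall_2)
    have "n \<bullet> y = n \<bullet> x" if "y \<in> K" for y
      using zero[OF that] by (simp add: n_def orient_def cross2_def inner_vec_def sum_2 algebra_simps)
    then have "K \<subseteq> {y. n \<bullet> y = n \<bullet> x}" by auto
    then have "interior K \<subseteq> {}"
      using interior_mono interior_hyperplane[OF \<open>n \<noteq> 0\<close>] by metis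
    with assms(3) show False by simp
  qed
  then have "orient x p q > 0" using nonneg[OF p(1) q(1)] p(2)[OF q(1)] by simp
  then show ?thesis using that[OF p(1) q(1)] nonneg p q by blast
qed

lemma orient_coordinates:
  assumes "orient x p q \<noteq> 0"
  shows "y = x + (orient x y q / orient x p q) *\<^sub>R (p - x) + (orient x p y / orient x p q) *\<^sub>R (q - x)"
proof -
  have "orient x p q *\<^sub>R (y - x) = orient x y q *\<^sub>R (p - x) + orient x p y *\<^sub>R (q - x)"
    by (simp add: vec_eq_iff forall_2 orient_def cross2_def algebra_simps)
  then have "(1 / orient x p q) *\<^sub>R (orient x p q *\<^sub>R (y - x)) =
      (1 / orient x p q) *\<^sub>R (orient x y q *\<^sub>R (p - x) + orient x p y *\<^sub>R (q - x))"
    by simp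
  then show ?thesis using assms by (simp add: scaleR_add_right algebra_simps)
qed

lemma orient_nonneg_triangle:
  assumes "z \<in> convex hull {x, p, q}" "orient x p q \<ge> 0"
  shows "orient z p q \<ge> 0"
proof -
  obtain u v where "z = x + u *\<^sub>R (p - x) + v *\<^sub>R (q - x)" "0 \<le> u" "0 \<le> v" "u + v \<le> 1"
    using assms(1) unfolding convex_hull_3_alt by auto
  then show ?thesis using orient_decompose(3)[of z x u p v q] assms(2) by simp
qed

context
  fixes x p q :: "real^2" and K :: "(real^2) set"
  assumes K: "convex K" "p \<in> K" "q \<in> K" and N: "orient x p q > 0"
    and tangent: "\<And>y. y \<in> K \<Longrightarrow> orient x p y \<ge> 0" "\<And>y. y \<in> K \<Longrightarrow> orient x y q \<ge> 0"
begin

lemma tangent_coordinates: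
  assumes "y \<in> K"
  obtains u v where "y = x + u *\<^sub>R (p - x) + v *\<^sub>R (q - x)" "0 \<le> u" "0 \<le> v"
  using orient_coordinates[of x p q y] tangent[OF assms] N that by (metis divide_nonneg_pos less_irrefl)

lemma halfplane_subset_tangent_triangle:
  assumes "y \<in> K" "orient y p q \<ge> 0"
  shows "y \<in> convex hull {x, p, q}"
proof -
  obtain u v where uv: "y = x + u *\<^sub>R (p - x) + v *\<^sub>R (q - x)" "0 \<le> u" "0 \<le> v"
    using tangent_coordinates[OF assms(1)] .
  then have "u + v \<le> 1"
    using orient_decompose(3)[OF uv(1)] assms(2) N by (simp add: zero_le_mult_iff)
  with uv show ?thesis unfolding convex_hull_3_alt by auto
qed

text \<open>
  A point \<open>z\<close> of the hull outside the triangle lies on a segment from \<open>x\<close> to some \<open>y\<close> in \<open>K\<close> and beyond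
  the point \<open>m\<close> where that segment crosses \<open>pq\<close>. So \<open>z\<close> lies between \<open>m\<close> and \<open>y\<close>, hence in \<open>K\<close>.
\<close>

lemma cap_subset_tangent_triangle:
  "convex hull ({x} \<union> K) - K \<subseteq> convex hull {x, p, q} - K"
proof
  fix z assume "z \<in> convex hull ({x} \<union> K) - K"
  then have z: "z \<in> convex hull (insert x K)" "z \<notin> K" by auto
  have "convex hull K = K" using K(1) by (rule convex_hull_eq[THEN iffD2])
  then obtain s t y where st: "0 \<le> s" "0 \<le> t" "y \<in> K" "s + t = 1" "z = s *\<^sub>R x + t *\<^sub>R y"
    using z(1) K(2) unfolding convex_hull_insert[of K x, OF ex_in_conv[THEN iffD1, OF exI, OF K(2)]] by auto
  obtain u v where uv: "y = x + u *\<^sub>R (p - x) + v *\<^sub>R (q - x)" "0 \<le> u" "0 \<le> v"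
    using tangent_coordinates[OF st(3)] .
  have s: "s = 1 - t" using st(4) by simp
  have zc: "z = x + (t * u) *\<^sub>R (p - x) + (t * v) *\<^sub>R (q - x)"
    unfolding st(5) uv(1) s by (simp add: algebra_simps)
  show "z \<in> convex hull {x, p, q} - K"
  proof (cases "t * u + t * v \<le> 1")
    case True
    then have "z \<in> convex hull {x, p, q}"
      unfolding convex_hull_3_alt using zc uv st(2) by force
    with z(2) show ?thesis by simp
  next
    case False
    define c where "c = u + v"
    have tc: "t * c > 1" using False by (simp add: c_def distrib_left)
    moreover have "t * c \<le> c" using st s uv by (simp add: c_def mult_left_le_one_le)
    ultimately have c: "c > 1" by simp
    define m where "m = (u / c) *\<^sub>R p + (v / c) *\<^sub>R q"
    have "u / c + v / c = 1" using c by (simp add: c_def add_divide_distrib[symmetric])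
    then have m: "m \<in> K" unfolding m_def using K uv c by (intro convexD) auto
    \<comment> \<open>The position of \<open>z\<close> between \<open>m\<close> and \<open>y\<close>: seen from \<open>x\<close>, these are at the ratios \<open>t * c\<close>, 1 and \<open>c\<close>.\<close>
    define \<theta> where "\<theta> = (t * c - 1) / (c - 1)"
    have \<theta>: "0 \<le> \<theta>" "\<theta> \<le> 1" using c tc \<open>t * c \<le> c\<close> by (simp_all add: \<theta>_def)
    have mx: "c *\<^sub>R (m - x) = u *\<^sub>R (p - x) + v *\<^sub>R (q - x)"
      using c by (simp add: m_def c_def[symmetric] scaleR_diff_right scaleR_add_right)
         (simp add: c_def algebra_simps)
    have y: "y = x + c *\<^sub>R (m - x)"
      using uv(1) unfolding mx by (simp only: add.assoc)
    have "z = x + t *\<^sub>R (u *\<^sub>R (p - x) + v *\<^sub>R (q - x))"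
      using zc by (simp only: add.assoc scaleR_add_right scaleR_scaleR)
    then have z': "z = x + (t * c) *\<^sub>R (m - x)"
      unfolding mx[symmetric] by (simp only: scaleR_scaleR)
    have "\<theta> * (c - 1) = t * c - 1" using c by (simp add: \<theta>_def)
    then have tc': "t * c = 1 - \<theta> + \<theta> * c" by (simp add: algebra_simps)
    have "z = (1 - \<theta>) *\<^sub>R m + \<theta> *\<^sub>R y"
      unfolding z' y tc' by (simp add: algebra_simps)
    then have "z \<in> K" using convexD[OF K(1) m st(3), of "1 - \<theta>" \<theta>] \<theta> by simp
    with z(2) show ?thesis by simp
  qed
qed

end

text \<open>
  With \<open>p\<close>, \<open>q\<close> the tangent points from \<open>y\<close>, the area at \<open>y\<close> is exactly that of the triangle \<open>ypq\<close>
  minus its part in \<open>K\<close>. Replacing \<open>y\<close> by the end point \<open>x\<close> with the larger triangle can only shrink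
  the part to be subtracted, since \<open>xpq\<close> meets \<open>K\<close> only on the side of \<open>pq\<close> where \<open>K\<close> lies in \<open>ypq\<close>.
\<close>

proposition illumination_area_quasiconvex:
  assumes K: "compact K" "convex K" "K \<subseteq> hyp_plane" "interior K \<noteq> {}"
    and ab: "a \<in> hyp_plane" "b \<in> hyp_plane" "s \<in> {0..1}" and out: "line_pt a b s \<notin> K"
  obtains x where "x \<in> {a, b}"
    "emeasure hyp_area (convex hull ({line_pt a b s} \<union> K) - K)
      \<le> emeasure hyp_area (convex hull ({x} \<union> K) - K)"
proof -
  define y where "y = line_pt a b s"
  have y: "y \<in> hyp_plane" unfolding y_def by (rule line_pt_in_plane[OF ab])
  obtain p q where pq: "p \<in> K" "q \<in> K" and N: "orient y p q > 0"
    and tangent: "\<And>z. z \<in> K \<Longrightarrow> orient y p z \<ge> 0" "\<And>z. z \<in> K \<Longrightarrow> orient y z q \<ge> 0"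
    using exists_tangent_points[OF K(1,2,4) out] unfolding y_def by metis
  have pq': "p \<in> hyp_plane" "q \<in> hyp_plane" using pq K(3) by auto
  obtain x where x: "x \<in> {a, b}" "orient x p q > 0"
    and R: "orient y p q / tri_den y p q \<le> orient x p q / tri_den x p q"
    using orient_tri_den_quasiconvex[OF ab pq'] N unfolding y_def by metis
  have xp: "x \<in> hyp_plane" using x ab by auto
  let ?T = "\<lambda>z. convex hull {z, p, q}"
  have sets: "K \<in> sets hyp_area" "?T z \<in> sets hyp_area" for z
    unfolding hyp_area_def using K(1)
    by (auto intro!: borel_closed compact_imp_closed finite_imp_compact_convex_hull)
  have diff: "emeasure hyp_area (?T z - K) = emeasure hyp_area (?T z) - emeasure hyp_area (?T z \<inter> K)"
    if "z \<in> hyp_plane" "orient z p q > 0" for z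
  proof -
    have "emeasure hyp_area (?T z \<inter> K) \<le> emeasure hyp_area (?T z)"
      using sets by (intro emeasure_mono) auto
    also have "\<dots> < \<infinity>" using hyp_area_triangle[OF that(1) pq' that(2)] by simp
    finally have "emeasure hyp_area (?T z - ?T z \<inter> K) = emeasure hyp_area (?T z) - emeasure hyp_area (?T z \<inter> K)"
      using sets by (intro emeasure_Diff) auto
    then show ?thesis by (simp add: Diff_Int)
  qed
  have "emeasure hyp_area (convex hull ({y} \<union> K) - K) \<le> emeasure hyp_area (?T y - K)"
    using cap_subset_tangent_triangle[OF K(2) pq N tangent] sets by (intro emeasure_mono) auto
  also have "\<dots> = emeasure hyp_area (?T y) - emeasure hyp_area (?T y \<inter> K)"
    by (rule diff[OF y N])
  also have "\<dots> \<le> emeasure hyp_area (?T x) - emeasure hyp_area (?T x \<inter> K)"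
  proof (rule ennreal_minus_mono)
    show "emeasure hyp_area (?T y) \<le> emeasure hyp_area (?T x)"
      unfolding hyp_area_triangle[OF y pq' N] hyp_area_triangle[OF xp pq' x(2)]
      using R by (intro ennreal_leI mult_left_mono) (simp_all add: arctan_le_iff)
    have "?T x \<inter> K \<subseteq> ?T y \<inter> K"
      using halfplane_subset_tangent_triangle[OF K(2) pq N tangent] orient_nonneg_triangle[of _ x p q] x(2)
      by auto
    then show "emeasure hyp_area (?T x \<inter> K) \<le> emeasure hyp_area (?T y \<inter> K)"
      using sets by (intro emeasure_mono) auto
  qed
  also have "\<dots> = emeasure hyp_area (?T x - K)" by (rule diff[OF xp x(2), symmetric])
  also have "\<dots> \<le> emeasure hyp_area (convex hull ({x} \<union> K) - K)"
  proof (rule emeasure_mono)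
    show "?T x - K \<subseteq> convex hull ({x} \<union> K) - K" using pq by (intro Diff_mono hull_mono) auto
    have "compact (convex hull ({x} \<union> K))"
      using K(1) by (intro compact_convex_hull) auto
    then have "convex hull ({x} \<union> K) \<in> sets hyp_area"
      unfolding hyp_area_def by (simp add: borel_closed compact_imp_closed)
    then show "convex hull ({x} \<union> K) - K \<in> sets hyp_area"
      using sets(1) by (rule sets.Diff)
  qed
  finally show ?thesis using that[OF x(1)] by (simp add: y_def)
qed

section \<open>Convexity of the illumination body\<close>

theorem theorem1p3:
  fixes K :: "(real^2) set" and \<delta> :: real
  assumes "hyp_convex_body K" and "\<delta> > 0"
  shows "geod_convex (illumination_body \<delta> K)"
proof -
  have K: "compact K" "convex K" "K \<subseteq> hyp_plane" "interior K \<noteq> {}"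
    using assms(1) by (auto simp: hyp_convex_body_def geod_convex_iff_convex)
  define F where "F x = emeasure hyp_area (convex hull ({x} \<union> K) - K)" for x
  have body: "illumination_body \<delta> K = {x \<in> hyp_plane. F x \<le> ennreal \<delta>}"
    unfolding illumination_body_def F_def using K(3) by (auto simp: geod_convex_hull_eq)
  have "convex {x \<in> hyp_plane. F x \<le> ennreal \<delta>}"
    unfolding convex_alt
  proof (intro ballI allI impI)
    fix a b and s :: real
    assume ab: "a \<in> {x \<in> hyp_plane. F x \<le> ennreal \<delta>}" "b \<in> {x \<in> hyp_plane. F x \<le> ennreal \<delta>}"
      and "0 \<le> s \<and> s \<le> 1"
    then have s: "s \<in> {0..1}" by simp
    have ab': "a \<in> hyp_plane" "b \<in> hyp_plane" using ab by auto
    have "F (line_pt a b s) \<le> ennreal \<delta>"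
    proof (cases "line_pt a b s \<in> K")
      case True
      then have "convex hull ({line_pt a b s} \<union> K) = K"
        using K(2) by (simp add: insert_absorb convex_hull_eq)
      then show ?thesis by (simp add: F_def)
    next
      case False
      then show ?thesis
        using illumination_area_quasiconvex[OF K ab' s False] ab
        unfolding F_def by (metis (no_types, lifting) insertE mem_Collect_eq order_trans singletonD)
    qed
    then show "(1 - s) *\<^sub>R a + s *\<^sub>R b \<in> {x \<in> hyp_plane. F x \<le> ennreal \<delta>}"
      using line_pt_in_plane[OF ab' s] by (simp add: line_pt_def)
  qed
  then show ?thesis unfolding geod_convex_iff_convex body by auto
qed

end
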